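(* Let $p$ be a prime, and let $\alpha=(\ell_1,\dots,\ell_m)$ and $\tau=(k_1,\dots,k_n)$ be types with $\alpha\le\tau$. For $1\le j\le n$ let $f^\tau_\alpha(j)=\max\{i\in\{0,1,\dots,m\}\colon i=0\text{ or }\ell_i\ge k_j\}$, and let $u^\tau_\alpha=\max\{j-f^\tau_\alpha(j)\colon 1\le j\le n\}$. Then $$\min\{\mathrm{rk}(A(\tau)/N)\colon N\le A(\tau),\ \gamma(N)=\alpha\}=u^\tau_\alpha.$$
   Context: A type is a tuple of integers $(k_1,\dots,k_n)$ with $k_1\ge\cdots\ge k_n\ge1$; $A(\tau)=\prod_{i=1}^n\mathbb{Z}/p^{k_i}\mathbb{Z}$. For a finite abelian $p$-group $G$, $\gamma(G)$ is its type (the unique type $\tau$ with $G\cong A(\tau)$), and $\mathrm{rk}(G)$ is the minimal number of generators of $G$. For tuples $\eta=(\ell_1,\dots,\ell_m)$, $\tau=(k_1,\dots,k_n)$, $\eta\le\tau$ means $m\le n$ and $\ell_i\le k_i$ for all $i\le m$. *)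

theory Defs
  imports "HOL-Algebra.Algebra"
begin

definition is_type :: "nat list \<Rightarrow> bool" where
  "is_type ks \<longleftrightarrow> sorted_wrt (\<ge>) ks \<and> (\<forall>k \<in> set ks. k \<ge> 1)"

text \<open>The group A(tau) = prod_i Z/p^(k_i)Z, realised as functions nat => int
  that are supported on {0..<n} with i-th coordinate in {0..<p^(k_i)}.\<close>
definition A :: "nat \<Rightarrow> nat list \<Rightarrow> (nat \<Rightarrow> int) monoid" where
  "A p ks = \<lparr> carrier = {x. (\<forall>i < length ks. 0 \<le> x i \<and> x i < int p ^ (ks ! i))
                              \<and> (\<forall>i \<ge> length ks. x i = 0)},
             monoid.mult = (\<lambda>x y i. if i < length ks then (x i + y i) mod (int p ^ (ks ! i)) else 0),
             monoid.one = (\<lambda>i. 0) \<rparr>"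

definition gamma :: "nat \<Rightarrow> ('a, 'b) monoid_scheme \<Rightarrow> nat list" where
  "gamma p G = (THE ks. is_type ks \<and> G \<cong> A p ks)"

definition rk :: "('a, 'b) monoid_scheme \<Rightarrow> nat" where
  "rk G = (LEAST k. \<exists>S. S \<subseteq> carrier G \<and> finite S \<and> card S = k \<and> generate G S = carrier G)"

definition type_le :: "nat list \<Rightarrow> nat list \<Rightarrow> bool" where
  "type_le ls ks \<longleftrightarrow> length ls \<le> length ks \<and> (\<forall>i < length ls. ls ! i \<le> ks ! i)"

text \<open>f^tau_alpha(j) for 1 <= j <= n (1-based indices as in the paper).\<close>
definition f_fun :: "nat list \<Rightarrow> nat list \<Rightarrow> nat \<Rightarrow> nat" where
  "f_fun ls ks j = Max {i \<in> {0..length ls}. i = 0 \<or> ls ! (i - 1) \<ge> ks ! (j - 1)}"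

definition u_val :: "nat list \<Rightarrow> nat list \<Rightarrow> int" where
  "u_val ls ks = Max {int j - int (f_fun ls ks j) | j. j \<in> {1..length ks}}"

end

theory Submission
  imports Defs
begin

text \<open>Lower bound: suppose \<open>A(\<tau>)\<close> is generated by \<open>N \<cong> A(\<alpha>)\<close> and \<open>r\<close> further elements.
  Reduction of the first \<open>j\<close> coordinates modulo \<open>p\<close> is a map onto \<open>(\<int>/p)^j\<close> which kills all the
  standard generators of \<open>N\<close> except the first \<open>f(j)\<close>, so \<open>j \<le> f(j) + r\<close>. For \<open>r = 0\<close>, applied in both
  directions, this also shows that isomorphic groups have the same type.

  Upper bound: with \<open>u\<close> the claimed minimum, \<open>k\<^sub>i\<^sub>+\<^sub>u \<le> l\<^sub>i \<le> k\<^sub>i\<close>, and the elements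
  \<open>p^(k\<^sub>i - l\<^sub>i) x\<^sub>i + x\<^sub>i\<^sub>+\<^sub>u\<close> span a copy of \<open>A(\<alpha>)\<close> modulo which \<open>x\<^sub>1, \<dots>, x\<^sub>u\<close> generate.

  Since \<open>gamma\<close> is a definite description, \<open>gamma N = \<alpha>\<close> yields \<open>N \<cong> A(\<alpha>)\<close> only once every
  finite abelian \<open>p\<close>-group is known to have a type.\<close>

section \<open>Generators of \<open>A(\<tau>)\<close>\<close>

lemma carrier_A:
  "x \<in> carrier (A p ks) \<longleftrightarrow>
    (\<forall>i<length ks. 0 \<le> x i \<and> x i < int p ^ (ks ! i)) \<and> (\<forall>i\<ge>length ks. x i = 0)"
  by (simp add: A_def)

lemma one_A: "\<one>\<^bsub>A p ks\<^esub> = (\<lambda>i. 0)"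
  by (simp add: A_def)

lemma mult_A:
  "x \<otimes>\<^bsub>A p ks\<^esub> y = (\<lambda>i. if i < length ks then (x i + y i) mod (int p ^ (ks ! i)) else 0)"
  by (simp add: A_def)

lemma comm_group_A:
  assumes "p > 0"
  shows "comm_group (A p ks)"
proof (rule comm_groupI)
  fix x y z
  assume x: "x \<in> carrier (A p ks)"
  show "\<exists>y\<in>carrier (A p ks). y \<otimes>\<^bsub>A p ks\<^esub> x = \<one>\<^bsub>A p ks\<^esub>"
    using assms by (intro bexI[of _ "\<lambda>i. if i < length ks then (- x i) mod (int p ^ (ks ! i)) else 0"])
      (auto simp: mult_A one_A carrier_A mod_simps)
  show "\<one>\<^bsub>A p ks\<^esub> \<otimes>\<^bsub>A p ks\<^esub> x = x"
    using x by (auto simp: mult_A one_A carrier_A fun_eq_iff not_less)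
  show "x \<otimes>\<^bsub>A p ks\<^esub> y = y \<otimes>\<^bsub>A p ks\<^esub> x"
    by (simp add: mult_A add.commute cong: if_cong)
  show "x \<otimes>\<^bsub>A p ks\<^esub> y \<otimes>\<^bsub>A p ks\<^esub> z = x \<otimes>\<^bsub>A p ks\<^esub> (y \<otimes>\<^bsub>A p ks\<^esub> z)"
    by (auto simp: mult_A fun_eq_iff mod_simps add.assoc)
qed (use assms in \<open>auto simp: mult_A one_A carrier_A\<close>)

lemma card_carrier_A:
  "finite (carrier (A p ks)) \<and> card (carrier (A p ks)) = (\<Prod>i<length ks. p ^ (ks ! i))"
proof -
  let ?P = "PiE {..<length ks} (\<lambda>i. {0..<int p ^ (ks ! i)})"
  have bij: "bij_betw (\<lambda>x i. if i < length ks then x i else 0) ?P (carrier (A p ks))"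
    by (rule bij_betwI[where g = "\<lambda>x. restrict x {..<length ks}"])
      (auto simp: carrier_A PiE_def Pi_def extensional_def fun_eq_iff)
  have "finite ?P"
    by (intro finite_PiE) auto
  moreover have "card ?P = (\<Prod>i<length ks. p ^ (ks ! i))"
    by (simp add: card_PiE nat_power_eq)
  ultimately show ?thesis
    using bij_betw_finite[OF bij] bij_betw_same_card[OF bij] by simp
qed

lemma pow_A:
  assumes "p > 0" "x \<in> carrier (A p ks)"
  shows "x [^]\<^bsub>A p ks\<^esub> (n::nat) = (\<lambda>i. if i < length ks then (int n * x i) mod (int p ^ (ks ! i)) else 0)"
proof -
  interpret comm_group "A p ks" by (rule comm_group_A) fact
  show ?thesis
    by (induction n) (auto simp: one_A mult_A fun_eq_iff algebra_simps mod_simps)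
qed

text \<open>The coordinates of an element are cleared from the last one on.\<close>
lemma subgroup_A_eq_carrier:
  assumes "p > 0" and R: "subgroup R (A p ks)"
    and z: "\<And>t. t < length ks \<Longrightarrow> \<exists>z\<in>R. z t = 1 mod int p ^ (ks ! t) \<and> (\<forall>j>t. z j = 0)"
  shows "R = carrier (A p ks)"
proof -
  interpret comm_group "A p ks" by (rule comm_group_A) fact
  interpret R: subgroup R "A p ks" by fact
  have "g \<in> R" if "g \<in> carrier (A p ks)" "\<forall>j\<ge>t. g j = 0" "t \<le> length ks" for t g
    using that
  proof (induction t arbitrary: g)
    case 0
    then have "g = \<one>\<^bsub>A p ks\<^esub>" by (auto simp: one_A)
    then show ?case by simp
  next
    case (Suc t)
    then obtain z where z: "z \<in> R" "z t = 1 mod int p ^ (ks ! t)" "\<forall>j>t. z j = 0"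
      using z[of t] by auto
    \<comment> \<open>A nonnegative representative of \<open>- g t\<close>; hence the power
      \<open>w\<close> of \<open>z\<close> cancels the coordinate \<open>t\<close> of
      \<open>g\<close> without disturbing the zeros after it.\<close>
    define a where "a = nat (int p ^ (ks ! t) - g t)"
    have "g t < int p ^ (ks ! t)" using Suc.prems by (auto simp: carrier_A)
    then have a: "int a = int p ^ (ks ! t) - g t" by (simp add: a_def)
    define w where "w = z [^]\<^bsub>A p ks\<^esub> a"
    have w: "w \<in> R" unfolding w_def using z by (induction a) auto
    have "(w \<otimes>\<^bsub>A p ks\<^esub> g) t = 0"
      using z Suc.prems assms(1) by (simp add: w_def mult_A pow_A R.mem_carrier a mod_simps)
    moreover have "(w \<otimes>\<^bsub>A p ks\<^esub> g) j = 0" if "j > t" for j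
      using that z Suc.prems assms(1) by (simp add: w_def mult_A pow_A R.mem_carrier mod_simps)
    ultimately have "w \<otimes>\<^bsub>A p ks\<^esub> g \<in> R"
      using Suc.prems w by (intro Suc.IH) (auto simp: R.mem_carrier order.order_iff_strict)
    then have "inv\<^bsub>A p ks\<^esub> w \<otimes>\<^bsub>A p ks\<^esub> (w \<otimes>\<^bsub>A p ks\<^esub> g) \<in> R"
      using w by simp
    then show ?case
      using w Suc.prems by (simp add: R.mem_carrier m_assoc[symmetric])
  qed
  from this[of _ "length ks"] show ?thesis
    using R.subset by (auto simp: carrier_A)
qed

text \<open>The residue \<open>1 mod p ^ k\<close> instead of \<open>1\<close> keeps the tuple in
  the carrier for the exponent 0 as well, where the only residue is 0.\<close>

definition unit_A :: "nat \<Rightarrow> nat list \<Rightarrow> nat \<Rightarrow> nat \<Rightarrow> int" where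
  "unit_A p ks t = (\<lambda>i. if i = t then 1 mod int p ^ (ks ! t) else 0)"

lemma unit_A_closed: "p > 0 \<Longrightarrow> t < length ks \<Longrightarrow> unit_A p ks t \<in> carrier (A p ks)"
  by (auto simp: unit_A_def carrier_A)

lemma subgroup_A_eq_carrier_units:
  assumes "p > 0" "subgroup R (A p ks)" "\<And>t. t < length ks \<Longrightarrow> unit_A p ks t \<in> R"
  shows "R = carrier (A p ks)"
proof (rule subgroup_A_eq_carrier[OF assms(1,2)])
  fix t assume "t < length ks"
  then show "\<exists>z\<in>R. z t = 1 mod int p ^ (ks ! t) \<and> (\<forall>j>t. z j = 0)"
    using assms(3) by (intro bexI[of _ "unit_A p ks t"]) (auto simp: unit_A_def)
qed

section \<open>Preimages of subgroups and orders of generated subgroups\<close>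

lemma subgroup_hom_vimage:
  assumes "group G" "group H" "h \<in> hom G H" "subgroup W H"
  shows "subgroup {g \<in> carrier G. h g \<in> W} G"
proof -
  interpret group_hom G H h
    using assms by (simp add: group_hom_def group_hom_axioms_def)
  interpret W: subgroup W H by fact
  show ?thesis by (rule G.subgroupI) (auto intro: G.one_closed)
qed

text \<open>A new generator \<open>t\<close> multiplies the order by at most \<open>n\<close>: the
  products of old elements with \<open>t [^] a\<close>, \<open>a < n\<close>, already form a
  subgroup. With \<open>n = p\<close> this does the work of dimension over the field with
  \<open>p\<close> elements: a group of exponent \<open>p\<close> and order \<open>p ^ j\<close>
  needs at least \<open>j\<close> generators.\<close>

lemma (in comm_group) card_generate_le:
  assumes "finite T" "T \<subseteq> carrier G" "\<And>x. x \<in> carrier G \<Longrightarrow> x [^] n = \<one>" "n > (0::nat)"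
  shows "finite (generate G T) \<and> card (generate G T) \<le> n ^ card T"
  using assms(1,2)
proof (induction T)
  case empty
  then show ?case by (simp add: generate_empty)
next
  case (insert t T)
  then have t: "t \<in> carrier G" and T: "T \<subseteq> carrier G" by auto
  define C where "C = (\<lambda>(h, a). h \<otimes> t [^] a) ` (generate G T \<times> {..<n})"
  have tp: "t [^] m = t [^] (m mod n)" for m :: nat
  proof -
    have "t [^] m = t [^] (n * (m div n) + m mod n)" by simp
    also have "\<dots> = t [^] (m mod n)"
      using t assms(3)[OF t] by (simp only: nat_pow_mult[symmetric] nat_pow_pow[symmetric]) simp
    finally show ?thesis .
  qed
  have mem: "h \<otimes> t [^] m \<in> C" if "h \<in> generate G T" for h and m :: nat
    unfolding C_def using that tp[of m] \<open>n > 0\<close> by (intro image_eqI[of _ _ "(h, m mod n)"]) auto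
  have gT: "h \<in> carrier G" if "h \<in> generate G T" for h
    using generate_in_carrier[OF T that] .
  \<comment> \<open>Inverses are nonnegative powers as well, so natural exponents suffice to
    describe \<open>C\<close>.\<close>
  have inv: "inv t = t [^] (n - 1)"
  proof (rule inv_equality)
    have "t [^] (n - 1) \<otimes> t = t [^] Suc (n - 1)" by simp
    then show "t [^] (n - 1) \<otimes> t = \<one>"
      using assms(3)[OF t] \<open>n > 0\<close> by simp
  qed (use t in auto)
  have inv2: "inv (t [^] a) = t [^] ((n - 1) * a)" for a :: nat
    using t inv by (metis nat_pow_inv nat_pow_pow)
  have "subgroup C G"
  proof (rule subgroupI)
    show "C \<subseteq> carrier G" using gT t by (auto simp: C_def)
    show "C \<noteq> {}" using mem[OF generate.one] by blast
    fix a b assume "a \<in> C"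
    then obtain h i where a: "a = h \<otimes> t [^] (i::nat)" "h \<in> generate G T" by (auto simp: C_def)
    have "inv a = inv h \<otimes> t [^] ((n - 1) * i)"
      using a gT t by (simp add: inv_mult inv2)
    then show "inv a \<in> C"
      using mem generate_m_inv_closed[OF T a(2)] by simp
    assume "b \<in> C"
    then obtain h' i' where b: "b = h' \<otimes> t [^] (i'::nat)" "h' \<in> generate G T" by (auto simp: C_def)
    have "a \<otimes> b = (h \<otimes> h') \<otimes> t [^] (i + i')"
      using a b gT t by (simp add: nat_pow_mult[symmetric] m_ac)
    then show "a \<otimes> b \<in> C"
      using mem generate.eng[OF a(2) b(2)] by simp
  qed
  moreover have "insert t T \<subseteq> C"
  proof
    fix x assume "x \<in> insert t T"
    then consider "x = t" | "x \<in> T" by auto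
    then show "x \<in> C"
    proof cases
      case 1
      then show ?thesis using mem[OF generate.one, of 1] t by simp
    next
      case 2
      then show ?thesis using mem[OF generate.incl[OF 2], of 0] T by (simp add: subsetD)
    qed
  qed
  ultimately have sub: "generate G (insert t T) \<subseteq> C"
    by (simp add: generate_subgroup_incl)
  have fin: "finite C" unfolding C_def using insert T by simp
  have "card (generate G (insert t T)) \<le> card C"
    using card_mono[OF fin sub] .
  also have "\<dots> \<le> card (generate G T \<times> {..<n})"
    unfolding C_def using insert T by (intro card_image_le) auto
  also have "\<dots> \<le> n ^ card T * n"
    using insert T by (simp add: card_cartesian_product)
  finally show ?case
    using fin sub insert.hyps finite_subset by (auto simp: mult.commute)
qed

section \<open>The lower bound and uniqueness of types\<close>

lemma is_type_antimono:
  assumes "is_type ks" "i \<le> j" "j < length ks"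
  shows "ks ! j \<le> ks ! i"
  using assms sorted_wrt_nth_less[of "(\<ge>)" ks i j] by (cases "i = j") (auto simp: is_type_def)

text \<open>For a type \<open>ls\<close>, the entries that are at least \<open>ks ! (j - 1)\<close>
  form an initial segment of length \<open>f_fun ls ks j\<close>. Positions in \<open>ls\<close>
  count from 0 here, whereas \<open>j\<close> and the indices inside \<open>f_fun\<close> count from
  1.\<close>

lemma f_fun_le: "f_fun ls ks j \<le> length ls"
  and f_fun_nth: "\<lbrakk>is_type ls; i < f_fun ls ks j\<rbrakk> \<Longrightarrow> ks ! (j - 1) \<le> ls ! i"
  and f_fun_nth_less: "\<lbrakk>f_fun ls ks j \<le> i; i < length ls\<rbrakk> \<Longrightarrow> ls ! i < ks ! (j - 1)"
proof -
  let ?F = "{i \<in> {0..length ls}. i = 0 \<or> ls ! (i - 1) \<ge> ks ! (j - 1)}"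
  have F: "f_fun ls ks j \<in> ?F"
    unfolding f_fun_def by (rule Max_in) auto
  then show "f_fun ls ks j \<le> length ls" by simp
  show "ks ! (j - 1) \<le> ls ! i" if "is_type ls" "i < f_fun ls ks j"
  proof -
    have "ks ! (j - 1) \<le> ls ! (f_fun ls ks j - 1)" using F that by auto
    also have "\<dots> \<le> ls ! i" using F that by (intro is_type_antimono) auto
    finally show ?thesis .
  qed
  show "ls ! i < ks ! (j - 1)" if "f_fun ls ks j \<le> i" "i < length ls"
  proof (rule ccontr)
    assume "\<not> ls ! i < ks ! (j - 1)"
    then have "Suc i \<le> f_fun ls ks j"
      unfolding f_fun_def using that by (intro Max_ge) auto
    with that show False by simp
  qed
qed

text \<open>For \<open>i > f(j)\<close> the image \<open>h(e\<^sub>i)\<close> is annihilated by \<open>p^(l\<^sub>i)\<close>, while \<open>l\<^sub>i < k\<^sub>t\<close> for all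
  \<open>t \<le> j\<close>; hence its first \<open>j\<close> coordinates are divisible by \<open>p\<close>.\<close>
lemma f_fun_lower_bound:
  assumes p: "Factorial_Ring.prime p" and tau: "is_type tau" and j: "j \<in> {1..length tau}"
    and h: "h \<in> hom (A p alpha) (A p tau)"
    and S: "finite S" "S \<subseteq> carrier (A p tau)"
    and gen: "generate (A p tau) (h ` carrier (A p alpha) \<union> S) = carrier (A p tau)"
  shows "j \<le> f_fun alpha tau j + card S"
proof -
  define V where "V = A p (replicate j 1)"
  define \<pi> where "\<pi> = (\<lambda>g i. if i < j then g i mod int p else (0::int))"
  define f where "f = f_fun alpha tau j"
  have p0: "p > 0" and p1: "p > 1" using prime_gt_0_nat[OF p] prime_gt_1_nat[OF p] by auto
  interpret G: comm_group "A p tau" by (rule comm_group_A) fact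
  interpret B: comm_group "A p alpha" by (rule comm_group_A) fact
  interpret V: comm_group V unfolding V_def by (rule comm_group_A) fact
  \<comment> \<open>Positive exponents make \<open>p\<close> divide every modulus, so that reduction
    mod \<open>p\<close> is compatible with the addition of \<open>A p tau\<close>.\<close>
  have k1: "tau ! i \<ge> 1" if "i < j" for i using that tau j by (auto simp: is_type_def)
  have pdvd: "int p dvd int p ^ (tau ! i)" if "i < j" for i
    using k1[OF that] by (simp add: dvd_power)
  interpret h: group_hom "A p alpha" "A p tau" h by unfold_locales (fact h)
  have \<pi>_hom: "\<pi> \<in> hom (A p tau) V"
  proof (rule homI)
    fix x y
    show "\<pi> (x \<otimes>\<^bsub>A p tau\<^esub> y) = \<pi> x \<otimes>\<^bsub>V\<^esub> \<pi> y"
      using j pdvd by (auto simp: \<pi>_def V_def mult_A fun_eq_iff mod_mod_cancel mod_simps)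
  qed (use p0 in \<open>auto simp: \<pi>_def V_def carrier_A\<close>)
  have \<pi>_surj: "\<pi> ` carrier (A p tau) = carrier V"
  proof
    \<comment> \<open>A tuple of residues mod \<open>p\<close> also lies in \<open>A p tau\<close>,
      whose moduli are no smaller, and it reduces to itself.\<close>
    show "carrier V \<subseteq> \<pi> ` carrier (A p tau)"
    proof
      fix v assume v: "v \<in> carrier V"
      have "v i < int p ^ (tau ! i)" if "i < j" for i
      proof -
        have "v i < int p" using v that by (simp add: V_def carrier_A)
        also have "int p \<le> int p ^ (tau ! i)"
          using k1[OF that] p0 by (intro self_le_power) auto
        finally show ?thesis .
      qed
      moreover have "v i = 0" if "j \<le> i" for i
        using v that by (simp add: V_def carrier_A)
      ultimately have "v \<in> carrier (A p tau)"
        using v j p0 by (auto simp: V_def carrier_A) (metis linorder_not_less zero_less_power of_nat_0_less_iff order.refl)+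
      moreover have "\<pi> v = v"
        using v by (auto simp: V_def carrier_A \<pi>_def fun_eq_iff not_less)
      ultimately show "v \<in> \<pi> ` carrier (A p tau)" by (metis image_eqI)
    qed
  qed (use \<pi>_hom in \<open>auto simp: hom_def\<close>)
  define T where "T = (\<lambda>i. \<pi> (h (unit_A p alpha i))) ` {..<f} \<union> \<pi> ` S"
  have f: "f \<le> length alpha" unfolding f_def by (rule f_fun_le)
  have h_closed: "h x \<in> carrier (A p tau)" if "x \<in> carrier (A p alpha)" for x
    using h that by (auto simp: hom_def)
  have \<pi>_closed: "\<pi> x \<in> carrier V" if "x \<in> carrier (A p tau)" for x
    using \<pi>_hom that by (auto simp: hom_def)
  have T: "finite T" "T \<subseteq> carrier V"
    using S f by (auto simp: T_def intro!: \<pi>_closed h_closed unit_A_closed p0)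
  have "card T \<le> card ((\<lambda>i. \<pi> (h (unit_A p alpha i))) ` {..<f}) + card (\<pi> ` S)"
    unfolding T_def by (rule card_Un_le)
  also have "\<dots> \<le> f + card S"
    using S card_image_le[of "{..<f}" "\<lambda>i. \<pi> (h (unit_A p alpha i))"] card_image_le[of S \<pi>] by simp
  finally have cT: "card T \<le> f + card S" .
  define W where "W = generate V T"
  have W: "subgroup W V" unfolding W_def by (rule V.generate_is_subgroup) fact
  \<comment> \<open>To show that \<open>T\<close> generates \<open>V\<close>, its span
    \<open>W\<close> is pulled back along \<open>\<pi>\<close> and then along \<open>h\<close>; a
    subgroup of \<open>A p alpha\<close> is everything once it contains the unit tuples.\<close>
  define R where "R = {g \<in> carrier (A p tau). \<pi> g \<in> W}"
  have R: "subgroup R (A p tau)"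
    unfolding R_def by (rule subgroup_hom_vimage[OF G.is_group V.is_group \<pi>_hom W])
  have kill: "\<pi> (h (unit_A p alpha i)) = \<one>\<^bsub>V\<^esub>" if i: "f \<le> i" "i < length alpha" for i
  proof -
    let ?e = "unit_A p alpha i"
    have e: "?e \<in> carrier (A p alpha)" using i p0 by (intro unit_A_closed)
    have "?e [^]\<^bsub>A p alpha\<^esub> (p ^ (alpha ! i)) = \<one>\<^bsub>A p alpha\<^esub>"
      unfolding pow_A[OF p0 e] by (auto simp: one_A unit_A_def)
    moreover have "h (?e [^]\<^bsub>A p alpha\<^esub> (p ^ (alpha ! i))) = h ?e [^]\<^bsub>A p tau\<^esub> (p ^ (alpha ! i))"
      using e by (rule h.hom_nat_pow)
    moreover have "h \<one>\<^bsub>A p alpha\<^esub> = \<one>\<^bsub>A p tau\<^esub>"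
      by (rule h.hom_one)
    ultimately have eq: "h ?e [^]\<^bsub>A p tau\<^esub> (p ^ (alpha ! i)) = (\<lambda>i. 0)"
      by (simp add: one_A)
    have "int p dvd h ?e t" if t: "t < j" for t
    proof -
      have "int (p ^ (alpha ! i)) * h ?e t mod int p ^ (tau ! t) = 0"
        using fun_cong[OF eq, of t] t j unfolding pow_A[OF p0 h_closed[OF e]] by simp
      then have "int p ^ (tau ! t) dvd int p ^ (alpha ! i) * h ?e t"
        by auto
      moreover have "alpha ! i < tau ! t"
      proof -
        have "alpha ! i < tau ! (j - 1)" using i unfolding f_def by (rule f_fun_nth_less)
        also have "\<dots> \<le> tau ! t" using t j by (intro is_type_antimono tau) auto
        finally show ?thesis .
      qed
      then have "int p ^ Suc (alpha ! i) dvd int p ^ (tau ! t)"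
        by (intro le_imp_power_dvd) simp
      ultimately have "int p ^ (alpha ! i) * int p dvd int p ^ (alpha ! i) * h ?e t"
        using dvd_trans by (fastforce simp: mult.commute)
      then show ?thesis using p0 by simp
    qed
    then show ?thesis by (auto simp: \<pi>_def V_def one_A fun_eq_iff)
  qed
  have "{c \<in> carrier (A p alpha). h c \<in> R} = carrier (A p alpha)"
  proof (rule subgroup_A_eq_carrier_units[OF p0])
    show "subgroup {c \<in> carrier (A p alpha). h c \<in> R} (A p alpha)"
      by (rule subgroup_hom_vimage[OF B.is_group G.is_group h R])
    fix i assume i: "i < length alpha"
    have "\<pi> (h (unit_A p alpha i)) \<in> W"
    proof (cases "i < f")
      case True
      then show ?thesis unfolding W_def by (intro generate.incl) (auto simp: T_def)
    next
      case False
      then show ?thesis using kill[of i] i W by (simp add: subgroup.one_closed)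
    qed
    then show "unit_A p alpha i \<in> {c \<in> carrier (A p alpha). h c \<in> R}"
      using i p0 by (simp add: R_def h_closed unit_A_closed)
  qed
  moreover have "s \<in> R" if "s \<in> S" for s
    using that S by (auto simp: R_def W_def T_def intro: generate.incl)
  ultimately have "h ` carrier (A p alpha) \<union> S \<subseteq> R" by auto
  then have "carrier (A p tau) \<subseteq> R"
    unfolding gen[symmetric] by (rule G.generate_subgroup_incl[OF _ R])
  then have "\<pi> g \<in> W" if "g \<in> carrier (A p tau)" for g
    using that unfolding R_def by blast
  then have "carrier V \<subseteq> W"
    unfolding \<pi>_surj[symmetric] by blast
  then have "carrier V = W" using W subgroup.subset by blast
  moreover have "card (carrier V) = p ^ j"
    using card_carrier_A[of p "replicate j 1"] by (simp add: V_def)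
  moreover have "x [^]\<^bsub>V\<^esub> p = \<one>\<^bsub>V\<^esub>" if "x \<in> carrier V" for x
    using that p0 by (auto simp: V_def pow_A one_A fun_eq_iff)
  then have "card W \<le> p ^ card T"
    unfolding W_def using V.card_generate_le[OF T, of p] p0 by blast
  ultimately have "p ^ j \<le> p ^ card T" by simp
  then have "j \<le> card T" using p1 by (rule power_le_imp_le_exp[rotated])
  then show ?thesis using cT unfolding f_def by (rule order.trans)
qed

lemma type_iso_imp_eq:
  assumes p: "Factorial_Ring.prime p" and "is_type ls" "is_type ks" "A p ls \<cong> A p ks"
  shows "ls = ks"
proof -
  have le: "length ks \<le> length ls \<and> (\<forall>i<length ks. ks ! i \<le> ls ! i)"
    if types: "is_type ls" "is_type ks" and iso: "A p ls \<cong> A p ks" for ls ks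
  proof -
    have p0: "p > 0" using p by (simp add: prime_gt_0_nat)
    interpret K: comm_group "A p ks" by (rule comm_group_A) fact
    from iso obtain h where h: "h \<in> iso (A p ls) (A p ks)" by (auto simp: is_iso_def)
    then have img: "h ` carrier (A p ls) = carrier (A p ks)" and hom: "h \<in> hom (A p ls) (A p ks)"
      by (auto simp: iso_def bij_betw_def)
    have gen: "generate (A p ks) (h ` carrier (A p ls) \<union> {}) = carrier (A p ks)"
      using img K.generateI[OF K.subgroup_self, of "carrier (A p ks)"] by simp
    \<comment> \<open>An isomorphism is onto, so no extra generators occur and \<open>r = 0\<close>.
      Then \<open>j = i + 1\<close> compares the entries at position \<open>i\<close>, and
      \<open>j = length ks\<close> compares the lengths.\<close>
    have f: "j \<le> f_fun ls ks j" if "j \<in> {1..length ks}" for j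
      using f_fun_lower_bound[OF p types(2) that hom _ _ gen] by simp
    have "ks ! i \<le> ls ! i" if "i < length ks" for i
      using f[of "Suc i"] f_fun_nth[OF types(1), of i ks "Suc i"] that by simp
    moreover have "length ks \<le> length ls"
      using f[of "length ks"] f_fun_le[of ls ks "length ks"] by (cases ks) auto
    ultimately show ?thesis by blast
  qed
  have "A p ks \<cong> A p ls"
    using assms(4) comm_group_A[of p ls] p group.iso_sym by (auto simp: comm_group_def prime_gt_0_nat)
  then have "length ls = length ks" "\<forall>i<length ls. ls ! i = ks ! i"
    using le[OF assms(2-4)] le[OF assms(3,2)] by (auto intro: order.antisym)
  then show ?thesis by (simp add: nth_equalityI)
qed

section \<open>Finite abelian p-groups have a type\<close>

lemma (in comm_group) int_pow_mod:
  assumes "x \<in> carrier G" "x [^] (n::int) = \<one>"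
  shows "x [^] (a mod n) = x [^] a"
proof -
  have "x [^] a = x [^] (n * (a div n) + a mod n)" by simp
  also have "\<dots> = x [^] (a mod n)"
    using assms by (simp only: int_pow_mult int_pow_pow[symmetric] int_pow_one) simp
  finally show ?thesis by simp
qed

lemma (in comm_group) finprod_int_pow:
  assumes "\<And>i. i \<in> I \<Longrightarrow> x i \<in> carrier G"
  shows "finprod G x I [^] (n::int) = (\<Otimes>i\<in>I. x i [^] n)"
  using assms by (induction I rule: infinite_finite_induct) (auto simp: int_pow_distrib Pi_def)

text \<open>Exchange argument: given a relation, divide it by the largest possible power \<open>p^e\<close>; the
  resulting element \<open>w\<close> has order dividing \<open>p^e\<close> and can replace a generator whose exponent in
  the divided relation is a unit.\<close>
lemma (in comm_group) exchange_generator: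
  fixes x :: "'i \<Rightarrow> 'a" and k :: "'i \<Rightarrow> nat" and c :: "'i \<Rightarrow> int"
  assumes p: "Factorial_Ring.prime p" and I: "finite I"
    and x: "\<And>i. i \<in> I \<Longrightarrow> x i \<in> carrier G"
    and ord: "\<And>i. i \<in> I \<Longrightarrow> x i [^] (int p ^ k i) = \<one>"
    and gen: "\<And>g. g \<in> carrier G \<Longrightarrow> \<exists>c::'i \<Rightarrow> int. g = (\<Otimes>i\<in>I. x i [^] c i)"
    and rel: "(\<Otimes>i\<in>I. x i [^] c i) = \<one>" and i: "i \<in> I" "\<not> int p ^ k i dvd c i"
  obtains i0 w e where "i0 \<in> I" "e < k i0" "w \<in> carrier G" "w [^] (int p ^ e) = \<one>"
    "\<forall>g\<in>carrier G. \<exists>c::'i \<Rightarrow> int. g = (\<Otimes>i\<in>I. (x(i0 := w)) i [^] c i)"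
proof -
  have p': "Factorial_Ring.prime (int p)" using p by simp
  \<comment> \<open>The indices at which the relation is not already forced by the orders. Among
    them \<open>i0\<close> has the least power of \<open>p\<close> in its exponent, so
    \<open>p ^ e\<close> divides all exponents over \<open>J\<close>.\<close>
  define J where "J = {i \<in> I. \<not> int p ^ k i dvd c i}"
  have "finite J" "J \<noteq> {}" using I i by (auto simp: J_def)
  then obtain i0 where i0: "i0 \<in> J"
    and min: "\<And>i. i \<in> J \<Longrightarrow> multiplicity (int p) (c i0) \<le> multiplicity (int p) (c i)"
    using ex_min_if_finite[of "(\<lambda>i. multiplicity (int p) (c i)) ` J"] by (auto simp: not_less)
  have i0I: "i0 \<in> I" using i0 by (simp add: J_def)
  define e where "e = multiplicity (int p) (c i0)"
  have c0: "c i0 \<noteq> 0" using i0 by (auto simp: J_def)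
  have e: "e < k i0"
    using i0 by (auto simp: J_def e_def intro: multiplicity_dvd' not_le_imp_less)
  \<comment> \<open>Outside \<open>J\<close> the exponent \<open>c i\<close> need not be divisible
    by \<open>p ^ e\<close>, but there \<open>x i [^] c i\<close> is trivial, so 0 is a valid
    choice.\<close>
  define d where "d = (\<lambda>i. if i \<in> J then c i div int p ^ e else 0)"
  have pd: "int p ^ e * d i = c i" if "i \<in> J" for i
    using that min[OF that] by (simp add: d_def e_def multiplicity_dvd')
  have "\<not> int p dvd d i0"
  proof
    assume "int p dvd d i0"
    then have "int p ^ e * int p dvd int p ^ e * d i0" by (rule mult_dvd_mono[OF dvd_refl])
    then have "int p ^ Suc e dvd c i0" unfolding pd[OF i0] by (simp add: mult.commute)
    then have "Suc e \<le> multiplicity (int p) (c i0)"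
      using c0 p' by (intro multiplicity_geI) auto
    then show False by (simp add: e_def)
  qed
  then have "coprime (d i0) (int p ^ k i0)"
    using p' prime_imp_coprime coprime_commute by (metis coprime_power_right_iff)
  \<comment> \<open>\<open>a\<close> inverts \<open>d i0\<close> modulo \<open>p ^ k i0\<close>, so
    \<open>x i0\<close> can be recovered from \<open>w\<close> and the other generators.\<close>
  then obtain a b where ab: "a * d i0 + b * int p ^ k i0 = 1"
    using bezout_int[of "d i0" "int p ^ k i0"] by (auto simp: coprime_iff_gcd_eq_1)
  define w where "w = (\<Otimes>i\<in>I. x i [^] d i)"
  have w: "w \<in> carrier G" unfolding w_def using x by auto
  have "w [^] (int p ^ e) = (\<Otimes>i\<in>I. x i [^] (d i * int p ^ e))"
    unfolding w_def using x by (subst finprod_int_pow) (auto simp: int_pow_pow simp_implies_def intro!: finprod_cong)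
  also have "\<dots> = (\<Otimes>i\<in>I. x i [^] c i)"
  proof (rule finprod_cong')
    fix i assume i: "i \<in> I"
    show "x i [^] (d i * int p ^ e) = x i [^] c i"
    proof (cases "i \<in> J")
      case True
      then show ?thesis using pd[OF True] by (simp add: mult.commute)
    next
      case False
      then obtain q where "c i = int p ^ k i * q" using i by (auto simp: J_def)
      then have "x i [^] c i = \<one>"
        using int_pow_pow[OF x[OF i], of "int p ^ k i" q] ord[OF i] by simp
      then show ?thesis using False by (simp add: d_def)
    qed
  qed (use x in auto)
  finally have "w [^] (int p ^ e) = \<one>" using rel by simp
  moreover have "\<exists>c::'i \<Rightarrow> int. g = (\<Otimes>i\<in>I. (x(i0 := w)) i [^] c i)" if g: "g \<in> carrier G" for g
  proof -
    obtain u where u: "g = (\<Otimes>i\<in>I. x i [^] (u i :: int))" using gen[OF g] by blast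
    let ?I = "I - {i0}"
    have split: "(\<Otimes>i\<in>I. f i) = f i0 \<otimes> (\<Otimes>i\<in>?I. f i)" if "\<And>i. i \<in> I \<Longrightarrow> f i \<in> carrier G" for f
    proof -
      have "(\<Otimes>i\<in>insert i0 ?I. f i) = f i0 \<otimes> (\<Otimes>i\<in>?I. f i)"
        using that I i0I by (intro finprod_insert) auto
      then show ?thesis using i0I by (simp add: insert_absorb)
    qed
    \<comment> \<open>\<open>w [^] (a * u i0)\<close> supplies the factor
      \<open>x i0 [^] u i0\<close>, because \<open>a * d i0\<close> is 1 modulo
      \<open>p ^ k i0\<close>; the surplus powers that it brings in at the other indices are
      subtracted.\<close>
    define v where "v = (\<lambda>i. if i = i0 then a * u i0 else u i - a * u i0 * d i)"
    have "(\<Otimes>i\<in>I. (x(i0 := w)) i [^] v i) = w [^] (a * u i0) \<otimes> (\<Otimes>i\<in>?I. x i [^] (u i - a * u i0 * d i))"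
      using x w by (subst split) (auto simp: v_def simp_implies_def intro!: arg_cong2[where f = "(\<otimes>)"] finprod_cong)
    also have "w [^] (a * u i0) = (\<Otimes>i\<in>I. x i [^] (a * u i0 * d i))"
      unfolding w_def using x
      by (subst finprod_int_pow) (auto simp: int_pow_pow mult.commute simp_implies_def intro!: finprod_cong)
    also have "\<dots> = x i0 [^] (a * u i0 * d i0) \<otimes> (\<Otimes>i\<in>?I. x i [^] (a * u i0 * d i))"
      using x by (subst split) auto
    also have "\<dots> \<otimes> (\<Otimes>i\<in>?I. x i [^] (u i - a * u i0 * d i))
        = x i0 [^] (a * u i0 * d i0) \<otimes> (\<Otimes>i\<in>?I. x i [^] (a * u i0 * d i) \<otimes> x i [^] (u i - a * u i0 * d i))"
      using x i0I by (subst finprod_multf) (auto simp: m_assoc)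
    also have "(\<Otimes>i\<in>?I. x i [^] (a * u i0 * d i) \<otimes> x i [^] (u i - a * u i0 * d i)) = (\<Otimes>i\<in>?I. x i [^] u i)"
      using x by (intro finprod_cong) (auto simp: int_pow_mult[symmetric] simp_implies_def)
    also have "x i0 [^] (a * u i0 * d i0) = x i0 [^] u i0"
    proof -
      have "a * u i0 * d i0 = u i0 + int p ^ k i0 * (- b * u i0)"
        using arg_cong[OF ab, of "\<lambda>z. z * u i0"] by (simp add: algebra_simps)
      moreover have "x i0 [^] (int p ^ k i0 * (- b * u i0)) = \<one>"
        using x[OF i0I] ord[OF i0I] by (simp only: int_pow_pow[symmetric] int_pow_one)
      ultimately show ?thesis using x[OF i0I] by (simp only: int_pow_mult) simp
    qed
    also have "x i0 [^] u i0 \<otimes> (\<Otimes>i\<in>?I. x i [^] u i) = g"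
      unfolding u using x by (subst split[of "\<lambda>i. x i [^] u i"]) auto
    finally show ?thesis by metis
  qed
  ultimately show thesis using that[OF i0I e w] by blast
qed

text \<open>Among the generating families with annihilating exponents, take one with the least sum
  of exponents: a relation not forced by the orders would let \<open>exchange_generator\<close>
  lower one exponent. Indexing by \<open>carrier G\<close> makes the identity family a starting
  point, and the index set stays fixed because trivial generators with exponent 0 may
  remain.\<close>

lemma (in comm_group) independent_generators:
  assumes p: "Factorial_Ring.prime p" and fin: "finite (carrier G)"
    and tors: "\<And>g. g \<in> carrier G \<Longrightarrow> \<exists>e::nat. g [^] (int p ^ e) = \<one>"
  obtains x :: "'a \<Rightarrow> 'a" and k :: "'a \<Rightarrow> nat" where
    "\<And>i. i \<in> carrier G \<Longrightarrow> x i \<in> carrier G"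
    "\<And>i. i \<in> carrier G \<Longrightarrow> x i [^] (int p ^ k i) = \<one>"
    "\<And>g. g \<in> carrier G \<Longrightarrow> \<exists>c::'a \<Rightarrow> int. g = (\<Otimes>i\<in>carrier G. x i [^] c i)"
    "\<And>(c::'a \<Rightarrow> int) i. \<lbrakk>(\<Otimes>i\<in>carrier G. x i [^] c i) = \<one>; i \<in> carrier G\<rbrakk> \<Longrightarrow> int p ^ k i dvd c i"
proof -
  let ?I = "carrier G"
  define P where "P = (\<lambda>(x, k). (\<forall>i\<in>?I. x i \<in> carrier G \<and> x i [^] (int p ^ k i) = \<one>) \<and>
    (\<forall>g\<in>carrier G. \<exists>c::'a \<Rightarrow> int. g = (\<Otimes>i\<in>?I. x i [^] c i)))"
  obtain k0 :: "'a \<Rightarrow> nat" where k0: "\<And>g. g \<in> ?I \<Longrightarrow> g [^] (int p ^ k0 g) = \<one>"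
    using tors by metis
  have "\<exists>c::'a \<Rightarrow> int. g = (\<Otimes>i\<in>?I. i [^] c i)" if "g \<in> ?I" for g
  proof
    have "(\<Otimes>i\<in>?I. i [^] (if g = i then 1 else 0 :: int)) = (\<Otimes>i\<in>?I. if g = i then i else \<one>)"
      by (intro finprod_cong) (auto simp: simp_implies_def)
    also have "\<dots> = g" using that fin by (intro finprod_singleton) auto
    finally show "g = (\<Otimes>i\<in>?I. i [^] (if g = i then 1 else 0 :: int))" by simp
  qed
  then have "P (\<lambda>i. i, k0)" using k0 by (auto simp: P_def)
  then obtain xk where xk: "P xk" "\<And>y. P y \<Longrightarrow> (\<Sum>i\<in>?I. snd xk i) \<le> (\<Sum>i\<in>?I. snd y i)"
    using ex_has_least_nat[of P _ "\<lambda>y. \<Sum>i\<in>?I. snd y i"] by blast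
  obtain x k where xk_eq: "xk = (x, k)" by force
  have 1: "x i \<in> carrier G" "x i [^] (int p ^ k i) = \<one>" if "i \<in> ?I" for i
    using xk(1) that by (auto simp: P_def xk_eq)
  have 2: "\<exists>c::'a \<Rightarrow> int. g = (\<Otimes>i\<in>carrier G. x i [^] c i)" if "g \<in> ?I" for g
    using xk(1) that by (auto simp: P_def xk_eq)
  have 3: "int p ^ k i dvd c i" if rel: "(\<Otimes>i\<in>carrier G. x i [^] c i) = \<one>" and i: "i \<in> ?I" for c i
  proof (rule ccontr)
    assume ndvd: "\<not> int p ^ k i dvd c i"
    show False
    proof (rule exchange_generator[where x = x and k = k and c = c, OF p fin 1 2 rel i ndvd])
      fix i0 w e
      assume w: "i0 \<in> ?I" "e < k i0" "w \<in> carrier G" "w [^] (int p ^ e) = \<one>"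
        "\<forall>g\<in>carrier G. \<exists>c::'a \<Rightarrow> int. g = (\<Otimes>i\<in>?I. (x(i0 := w)) i [^] c i)"
      then have "P (x(i0 := w), k(i0 := e))"
        using 1 by (simp add: P_def)
      then have "(\<Sum>i\<in>?I. k i) \<le> (\<Sum>i\<in>?I. (k(i0 := e)) i)"
        using xk(2) by (force simp: xk_eq)
      moreover have "(\<Sum>i\<in>?I. (k(i0 := e)) i) < (\<Sum>i\<in>?I. k i)"
        using w(1,2) fin by (intro sum_strict_mono_ex1) auto
      ultimately show False by simp
    qed
  qed
  show thesis by (rule that[of x k]) (fact 1 2 3)+
qed

text \<open>The isomorphism sends a tuple to the product of the corresponding powers. The orders
  make it compatible with reduction of coordinates, \<open>gen\<close> makes it onto, and
  \<open>ind\<close> makes it injective on reduced tuples.\<close>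

lemma (in comm_group) iso_A:
  fixes x :: "nat \<Rightarrow> 'a"
  assumes p: "p > 0"
    and x: "\<And>i. i < length ks \<Longrightarrow> x i \<in> carrier G"
    and ord: "\<And>i. i < length ks \<Longrightarrow> x i [^] (int p ^ (ks ! i)) = \<one>"
    and gen: "\<And>g. g \<in> carrier G \<Longrightarrow> \<exists>c::nat \<Rightarrow> int. g = (\<Otimes>i\<in>{..<length ks}. x i [^] c i)"
    and ind: "\<And>(c::nat \<Rightarrow> int) i. \<lbrakk>(\<Otimes>i\<in>{..<length ks}. x i [^] c i) = \<one>; i < length ks\<rbrakk>
      \<Longrightarrow> int p ^ (ks ! i) dvd c i"
  shows "A p ks \<cong> G"
proof -
  let ?I = "{..<length ks}"
  define \<phi> where "\<phi> = (\<lambda>c::nat \<Rightarrow> int. \<Otimes>i\<in>?I. x i [^] c i)"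
  have \<phi>_closed: "\<phi> c \<in> carrier G" for c unfolding \<phi>_def using x by auto
  have \<phi>_add: "\<phi> (\<lambda>i. c i + d i) = \<phi> c \<otimes> \<phi> d" for c d
  proof -
    have "\<phi> (\<lambda>i. c i + d i) = (\<Otimes>i\<in>?I. x i [^] c i \<otimes> x i [^] d i)"
      unfolding \<phi>_def using x by (intro finprod_cong) (auto simp: int_pow_mult simp_implies_def)
    also have "\<dots> = \<phi> c \<otimes> \<phi> d"
      unfolding \<phi>_def using x by (intro finprod_multf) auto
    finally show ?thesis .
  qed
  have \<phi>_mod: "\<phi> (\<lambda>i. if i < length ks then c i mod int p ^ (ks ! i) else 0) = \<phi> c" for c
    unfolding \<phi>_def using x ord by (intro finprod_cong) (auto simp: int_pow_mod simp_implies_def)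
  have hom: "\<phi> \<in> hom (A p ks) G"
    by (rule homI) (simp_all only: \<phi>_closed mult_A \<phi>_mod \<phi>_add)
  have "\<phi> ` carrier (A p ks) = carrier G"
  proof
    show "carrier G \<subseteq> \<phi> ` carrier (A p ks)"
    proof
      fix g assume "g \<in> carrier G"
      then obtain c where c: "g = \<phi> c" using gen unfolding \<phi>_def by blast
      let ?c = "\<lambda>i. if i < length ks then c i mod int p ^ (ks ! i) else 0"
      have "\<phi> ?c \<in> \<phi> ` carrier (A p ks)" using p by (intro imageI) (auto simp: carrier_A)
      then show "g \<in> \<phi> ` carrier (A p ks)" unfolding \<phi>_mod c .
    qed
  qed (use \<phi>_closed in blast)
  moreover have "inj_on \<phi> (carrier (A p ks))"
  proof (rule inj_onI)
    fix c d assume c: "c \<in> carrier (A p ks)" and d: "d \<in> carrier (A p ks)" and eq: "\<phi> c = \<phi> d"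
    \<comment> \<open>\<open>\<phi>\<close> is additive on all integer functions, so the difference
      \<open>c - d\<close> may be used although it need not be a reduced tuple.\<close>
    have "\<phi> (\<lambda>i. (c i - d i) + d i) = \<phi> (\<lambda>i. c i - d i) \<otimes> \<phi> d" by (rule \<phi>_add)
    then have "\<phi> (\<lambda>i. c i - d i) = \<one>"
      using eq \<phi>_closed[of d] \<phi>_closed[of "\<lambda>i. c i - d i"] by (simp add: l_cancel_one')
    then have dvd: "int p ^ (ks ! i) dvd c i - d i" if "i < length ks" for i
      using ind[of "\<lambda>i. c i - d i" i] that by (simp add: \<phi>_def)
    show "c = d"
    proof
      fix i show "c i = d i"
      proof (cases "i < length ks")
        case True
        then have "c i mod int p ^ (ks ! i) = d i mod int p ^ (ks ! i)"
          using dvd by (simp add: mod_eq_dvd_iff)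
        then show ?thesis using True c d by (simp add: carrier_A)
      qed (use c d in \<open>simp add: carrier_A\<close>)
    qed
  qed
  ultimately have "\<phi> \<in> iso (A p ks) G"
    using hom by (simp add: iso_def bij_betw_def)
  then show ?thesis by (auto simp: is_iso_def)
qed

theorem (in comm_group) ex_type:
  assumes p: "Factorial_Ring.prime p" and fin: "finite (carrier G)"
    and tors: "\<And>g. g \<in> carrier G \<Longrightarrow> \<exists>e::nat. g [^] (int p ^ e) = \<one>"
  shows "\<exists>ks. is_type ks \<and> A p ks \<cong> G"
proof -
  obtain x :: "'a \<Rightarrow> 'a" and k :: "'a \<Rightarrow> nat" where
    x: "\<And>i. i \<in> carrier G \<Longrightarrow> x i \<in> carrier G" and
    ord: "\<And>i. i \<in> carrier G \<Longrightarrow> x i [^] (int p ^ k i) = \<one>" and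
    gen: "\<And>g. g \<in> carrier G \<Longrightarrow> \<exists>c::'a \<Rightarrow> int. g = (\<Otimes>i\<in>carrier G. x i [^] c i)" and
    ind: "\<And>(c::'a \<Rightarrow> int) i. \<lbrakk>(\<Otimes>i\<in>carrier G. x i [^] c i) = \<one>; i \<in> carrier G\<rbrakk> \<Longrightarrow> int p ^ k i dvd c i"
    using independent_generators[OF assms] by blast
  define I where "I = {i \<in> carrier G. k i \<ge> 1}"
  obtain xs where xs: "set xs = I" "distinct xs"
    using finite_distinct_list[of I] fin by (auto simp: I_def)
  define l where "l = rev (sort_key k xs)"
  have l: "set l = I" "distinct l" using xs by (auto simp: l_def)
  have bij: "bij_betw ((!) l) {..<length l} I"
    using bij_betw_nth[OF l(2)] l(1) by (simp add: lessThan_atLeast0)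
  have I: "I \<subseteq> carrier G" by (auto simp: I_def)
  have triv: "x i = \<one>" if "i \<in> carrier G - I" for i
  proof -
    have "k i = 0" using that by (auto simp: I_def)
    then show ?thesis using ord[of i] x[of i] that by simp
  qed
  have prod: "(\<Otimes>i\<in>{..<length l}. x (l ! i) [^] (c (l ! i) :: int)) = (\<Otimes>i\<in>carrier G. x i [^] c i)" for c
  proof -
    have "(\<Otimes>i\<in>carrier G. x i [^] c i) = (\<Otimes>i\<in>I. x i [^] c i)"
      using fin I x triv by (intro finprod_mono_neutral_cong_right) auto
    also have "\<dots> = (\<Otimes>i\<in>(!) l ` {..<length l}. x i [^] c i)"
      using bij by (simp add: bij_betw_def)
    also have "\<dots> = (\<Otimes>i\<in>{..<length l}. x (l ! i) [^] c (l ! i))"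
      using bij I x by (intro finprod_reindex) (auto simp: bij_betw_def)
    finally show ?thesis by simp
  qed
  have lI: "l ! i \<in> carrier G" if "i < length l" for i
    using that l(1) I nth_mem by blast
  let ?ks = "map k l"
  have "is_type ?ks"
  proof -
    have "sorted (map k (sort_key k xs))" by simp
    then have "sorted_wrt (\<ge>) ?ks"
      unfolding l_def rev_map[symmetric] by (simp add: sorted_wrt_rev)
    then show ?thesis using l(1) by (auto simp: is_type_def I_def)
  qed
  moreover have "A p ?ks \<cong> G"
  proof (rule iso_A[where x = "\<lambda>i. x (l ! i)"])
    fix g assume "g \<in> carrier G"
    then obtain c where "g = (\<Otimes>i\<in>carrier G. x i [^] (c i :: int))" using gen by blast
    then show "\<exists>c::nat \<Rightarrow> int. g = (\<Otimes>i\<in>{..<length ?ks}. x (l ! i) [^] c i)"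
      using prod[of c] by (intro exI[of _ "\<lambda>i. c (l ! i)"]) simp
  next
    fix c :: "nat \<Rightarrow> int" and i
    assume rel: "(\<Otimes>i\<in>{..<length ?ks}. x (l ! i) [^] c i) = \<one>" and i: "i < length ?ks"
    \<comment> \<open>\<open>ind\<close> speaks of exponents indexed by \<open>carrier G\<close>, so
      \<open>c\<close> is carried over along the enumeration \<open>l\<close>. Off \<open>I\<close>
      the values are arbitrary, which is harmless as \<open>x\<close> is trivial there.\<close>
    define d where "d = (\<lambda>j. c (the_inv_into {..<length l} ((!) l) j))"
    have d: "d (l ! j) = c j" if "j < length l" for j
      unfolding d_def using that bij by (subst the_inv_into_f_f) (auto simp: bij_betw_def)
    have "(\<Otimes>i\<in>{..<length l}. x (l ! i) [^] d (l ! i)) = (\<Otimes>i\<in>{..<length l}. x (l ! i) [^] c i)"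
      using lI x by (intro finprod_cong) (auto simp: d simp_implies_def)
    then have "int p ^ k (l ! i) dvd d (l ! i)"
      using rel i lI by (intro ind) (simp_all add: prod)
    then show "int p ^ (?ks ! i) dvd c i" using i by (simp add: d)
  qed (use p lI x ord in \<open>auto simp: prime_gt_0_nat\<close>)
  ultimately show ?thesis by blast
qed

section \<open>Quotients and the upper bound\<close>

text \<open>Forwards, each \<open>g\<close> shares its coset with an element of the subgroup
  generated by \<open>H\<close> and \<open>S\<close>, and so differs from it by an element of
  \<open>H\<close>. Backwards, the elements of \<open>H\<close> become trivial in the
  quotient.\<close>

lemma (in normal) generate_FactGroup_iff:
  assumes S: "S \<subseteq> carrier G"
  shows "generate (G Mod H) ((#>) H ` S) = carrier (G Mod H) \<longleftrightarrow> generate G (H \<union> S) = carrier G"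
proof -
  interpret Q: group_hom G "G Mod H" "(#>) H"
    using factorgroup_is_group r_coset_hom_Mod
    by (simp add: group_hom_def group_hom_axioms_def is_group)
  let ?R = "generate G (H \<union> S)"
  have HS: "H \<union> S \<subseteq> carrier G" using S subset by auto
  have R: "subgroup ?R G" using HS by (rule generate_is_subgroup)
  have img: "(#>) H ` ?R = generate (G Mod H) ((#>) H ` (H \<union> S))"
    using Q.generate_img[OF HS] by simp
  have Q_img: "(#>) H ` carrier G = carrier (G Mod H)"
    by (auto simp: FactGroup_def RCOSETS_def)
  show ?thesis
  proof
    assume "generate (G Mod H) ((#>) H ` S) = carrier (G Mod H)"
    moreover have "generate (G Mod H) ((#>) H ` S) \<subseteq> generate (G Mod H) ((#>) H ` (H \<union> S))"
      by (intro Q.H.mono_generate) auto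
    ultimately have sub: "carrier (G Mod H) \<subseteq> (#>) H ` ?R" using img by simp
    have "g \<in> ?R" if g: "g \<in> carrier G" for g
    proof -
      obtain r where r: "r \<in> ?R" "H #> g = H #> r"
        using sub g Q_img by blast
      have "g \<in> H #> r" using rcos_self[OF g is_subgroup] r by simp
      then obtain x where x: "x \<in> H" "g = x \<otimes> r" by (auto simp: r_coset_def)
      then have "x \<in> ?R" by (intro generate.incl) simp
      then show ?thesis using x r by (simp add: generate.eng)
    qed
    then show "?R = carrier G" using subgroup.subset[OF R] by blast
  next
    assume "?R = carrier G"
    then have eq: "generate (G Mod H) ((#>) H ` (H \<union> S)) = carrier (G Mod H)"
      using img Q_img by simp
    have cl: "(#>) H ` S \<subseteq> carrier (G Mod H)" using S Q_img by blast
    have "(#>) H ` (H \<union> S) \<subseteq> generate (G Mod H) ((#>) H ` S)"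
    proof
      fix C assume "C \<in> (#>) H ` (H \<union> S)"
      then consider x where "x \<in> H" "C = H #> x" | "C \<in> (#>) H ` S" by auto
      then show "C \<in> generate (G Mod H) ((#>) H ` S)"
      proof cases
        case 1
        then have "C = \<one>\<^bsub>G Mod H\<^esub>"
          using coset_join2[OF _ is_subgroup] subset by (auto simp: FactGroup_def)
        then show ?thesis by (simp only: generate.one)
      qed (rule generate.incl)
    qed
    then have "generate (G Mod H) ((#>) H ` (H \<union> S)) \<subseteq> generate (G Mod H) ((#>) H ` S)"
      by (rule Q.H.generate_subgroup_incl[OF _ Q.H.generate_is_subgroup[OF cl]])
    then show "generate (G Mod H) ((#>) H ` S) = carrier (G Mod H)"
      using eq Q.H.generate_in_carrier[OF cl] by blast
  qed
qed

lemma (in normal) rk_FactGroup_le: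
  assumes "finite S" "S \<subseteq> carrier G" "generate G (H \<union> S) = carrier G"
  shows "rk (G Mod H) \<le> card S"
proof -
  have "rk (G Mod H) \<le> card ((#>) H ` S)"
    unfolding rk_def
  proof (rule Least_le, intro exI conjI)
    show "(#>) H ` S \<subseteq> carrier (G Mod H)"
      using assms(2) by (auto simp: FactGroup_def RCOSETS_def)
    show "generate (G Mod H) ((#>) H ` S) = carrier (G Mod H)"
      using generate_FactGroup_iff[OF assms(2)] assms(3) by simp
  qed (use assms(1) in auto)
  also have "\<dots> \<le> card S" using assms(1) by (rule card_image_le)
  finally show ?thesis .
qed

text \<open>Finiteness ensures that the minimum defining \<open>rk\<close> is attained; choosing one
  representative for each coset of a smallest generating set preserves its cardinality.\<close>

lemma (in normal) rk_FactGroup_witness: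
  assumes "finite (carrier G)"
  obtains S where "finite S" "S \<subseteq> carrier G" "card S = rk (G Mod H)" "generate G (H \<union> S) = carrier G"
proof -
  interpret Q: group "G Mod H" by (rule factorgroup_is_group)
  have Q_img: "carrier (G Mod H) = (#>) H ` carrier G"
    by (auto simp: FactGroup_def RCOSETS_def)
  let ?P = "\<lambda>k. \<exists>S. S \<subseteq> carrier (G Mod H) \<and> finite S \<and> card S = k \<and> generate (G Mod H) S = carrier (G Mod H)"
  have "generate (G Mod H) (carrier (G Mod H)) = carrier (G Mod H)"
    using Q.generate_incl[OF order.refl] by (auto intro: generate.incl)
  then have "?P (card (carrier (G Mod H)))"
    using assms by (intro exI[of _ "carrier (G Mod H)"]) (auto simp: Q_img)
  then have "?P (rk (G Mod H))" unfolding rk_def by (rule LeastI)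
  then obtain T where T: "T \<subseteq> (#>) H ` carrier G" "card T = rk (G Mod H)"
    "generate (G Mod H) T = carrier (G Mod H)" unfolding Q_img by auto
  then obtain S where S: "S \<subseteq> carrier G" "inj_on ((#>) H) S" "T = (#>) H ` S"
    using subset_image_inj[of T "(#>) H" "carrier G"] by auto
  show thesis
  proof (rule that[of S])
    show "finite S" using S(1) assms by (rule finite_subset)
    show "card S = rk (G Mod H)" using S T by (simp add: card_image)
    show "generate G (H \<union> S) = carrier G"
      using generate_FactGroup_iff[OF S(1)] S T by simp
  qed (rule S)
qed

section \<open>Types of subgroups of \<open>A p tau\<close>\<close>

lemma gamma_eq_iff:
  assumes p: "Factorial_Ring.prime p" and G: "comm_group G" and fin: "finite (carrier G)"
    and tors: "\<And>g. g \<in> carrier G \<Longrightarrow> \<exists>e::nat. g [^]\<^bsub>G\<^esub> (int p ^ e) = \<one>\<^bsub>G\<^esub>"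
    and ks: "is_type ks"
  shows "gamma p G = ks \<longleftrightarrow> G \<cong> A p ks"
proof -
  interpret G: comm_group G by fact
  have A: "group (A p ls)" for ls
    using comm_group_A[of p ls] prime_gt_0_nat[OF p] by (simp add: comm_group_def)
  obtain ls where ls: "is_type ls" "G \<cong> A p ls"
    using G.ex_type[OF p fin tors] group.iso_sym[OF A] by blast
  have "ms = ls" if "is_type ms" "G \<cong> A p ms" for ms
    using type_iso_imp_eq[OF p that(1) ls(1)] iso_trans[OF G.iso_sym[OF that(2)] ls(2)] by blast
  then have "gamma p G = ls" and "\<And>ms. is_type ms \<Longrightarrow> G \<cong> A p ms \<Longrightarrow> ms = ls"
    unfolding gamma_def using ls by blast+
  then show ?thesis using ls ks by blast
qed

lemma gamma_subgroup_A_iff: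
  assumes p: "Factorial_Ring.prime p" and N: "subgroup N (A p tau)" and alpha: "is_type alpha"
  shows "gamma p ((A p tau)\<lparr>carrier := N\<rparr>) = alpha \<longleftrightarrow> (A p tau)\<lparr>carrier := N\<rparr> \<cong> A p alpha"
proof (rule gamma_eq_iff[OF p _ _ _ alpha])
  have p0: "p > 0" using prime_gt_0_nat[OF p] .
  interpret G: comm_group "A p tau" by (rule comm_group_A) fact
  show "comm_group ((A p tau)\<lparr>carrier := N\<rparr>)" 
    using G.m_comm subgroup.subset[OF N]
    by (intro group.group_comm_groupI G.subgroup_imp_group N) (auto dest: subsetD)
  show "finite (carrier ((A p tau)\<lparr>carrier := N\<rparr>))"
    using card_carrier_A[of p tau] subgroup.subset[OF N] finite_subset by auto
  fix g assume "g \<in> carrier ((A p tau)\<lparr>carrier := N\<rparr>)"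
  then have gN: "g \<in> N" and g: "g \<in> carrier (A p tau)" using subgroup.subset[OF N] by auto
  \<comment> \<open>The sum dominates each exponent, so \<open>p ^ ?e\<close> annihilates all
    coordinates at once.\<close>
  let ?e = "sum_list tau"
  have "int p ^ (tau ! i) dvd int (p ^ ?e)" if "i < length tau" for i
    using that member_le_sum_list[of "tau ! i" tau] by (simp add: le_imp_power_dvd)
  then have "g [^]\<^bsub>A p tau\<^esub> (p ^ ?e) = \<one>\<^bsub>A p tau\<^esub>"
    unfolding pow_A[OF p0 g] by (auto simp: one_A)
  then have "g [^]\<^bsub>A p tau\<^esub> (int p ^ ?e) = \<one>\<^bsub>A p tau\<^esub>"
    by (simp add: int_pow_int[symmetric])
  then show "\<exists>e. g [^]\<^bsub>(A p tau)\<lparr>carrier := N\<rparr>\<^esub> (int p ^ e) = \<one>\<^bsub>(A p tau)\<lparr>carrier := N\<rparr>\<^esub>"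
    using G.int_pow_consistent[OF N gN] by auto
qed

text \<open>For \<open>u = 0\<close> the summand \<open>x\<^sub>i\<^sub>+\<^sub>u\<close> is dropped from \<open>p^(k\<^sub>i - l\<^sub>i) x\<^sub>i + x\<^sub>i\<^sub>+\<^sub>u\<close>: otherwise the
  generators would be \<open>2 x\<^sub>i\<close>, which fails for \<open>p = 2\<close>.\<close>
lemma ex_subgroup_small_quotient:
  assumes p: "Factorial_Ring.prime p" and le: "type_le alpha tau" and u: "u \<le> length tau"
    and shift: "\<And>t. t < length tau \<Longrightarrow> u \<le> t \<Longrightarrow> t - u < length alpha \<and> tau ! t \<le> alpha ! (t - u)"
  shows "\<exists>N. subgroup N (A p tau) \<and> (A p tau)\<lparr>carrier := N\<rparr> \<cong> A p alpha \<and> rk (A p tau Mod N) \<le> u"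
proof -
  have p0: "p > 0" using prime_gt_0_nat[OF p] .
  interpret G: comm_group "A p tau" by (rule comm_group_A) fact
  interpret B: comm_group "A p alpha" by (rule comm_group_A) fact
  let ?n = "length tau" and ?m = "length alpha"
  have mn: "?m \<le> ?n" and lk: "\<And>i. i < ?m \<Longrightarrow> alpha ! i \<le> tau ! i"
    using le by (auto simp: type_le_def)
  \<comment> \<open>The linear combination of the generators of \<open>N\<close> with coefficients
    \<open>c\<close>, read off at coordinate \<open>t\<close>: contributions come from the
    generators with index \<open>t\<close> and \<open>t - u\<close>.\<close>
  define \<phi> where "\<phi> = (\<lambda>(c::nat \<Rightarrow> int) t. if t < ?n then
      ((if t < ?m then c t * int p ^ (tau ! t - alpha ! t) else 0) +
       (if 0 < u \<and> u \<le> t then c (t - u) else 0)) mod int p ^ (tau ! t) else 0)"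
  have \<phi>_closed: "\<phi> c \<in> carrier (A p tau)" for c
    using p0 by (auto simp: \<phi>_def carrier_A)
  have hom: "\<phi> \<in> hom (A p alpha) (A p tau)"
  proof (rule homI)
    fix a b
    show "\<phi> (a \<otimes>\<^bsub>A p alpha\<^esub> b) = \<phi> a \<otimes>\<^bsub>A p tau\<^esub> \<phi> b"
    proof
      fix t
      show "\<phi> (a \<otimes>\<^bsub>A p alpha\<^esub> b) t = (\<phi> a \<otimes>\<^bsub>A p tau\<^esub> \<phi> b) t"
      proof (cases "t < ?n")
        case True
        let ?q = "int p ^ (tau ! t)" and ?r = "int p ^ (tau ! t - alpha ! t)"
        define ab where "ab = a \<otimes>\<^bsub>A p alpha\<^esub> b"
        \<comment> \<open>Both summands respect reduction of \<open>c\<close>: a multiple of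
          \<open>p ^ (alpha ! t)\<close> times \<open>?r\<close> is a multiple of \<open>?q\<close>,
          and by \<open>shift\<close> the modulus at \<open>t - u\<close> in \<open>alpha\<close> is
          a multiple of \<open>?q\<close>.\<close>
        have 1: "(if t < ?m then ab t * ?r else 0) mod ?q = (if t < ?m then a t * ?r + b t * ?r else 0) mod ?q"
        proof (cases "t < ?m")
          case True
          have "int p ^ (alpha ! t) * ?r = ?q" using lk[OF True] by (simp add: power_add[symmetric])
          then have "ab t * ?r = (a t + b t) * ?r mod ?q"
            using True by (simp add: ab_def mult_A mult_mod_left)
          then show ?thesis using True by (simp add: distrib_right)
        qed simp
        have 2: "(if 0 < u \<and> u \<le> t then ab (t - u) else 0) mod ?q
            = (if 0 < u \<and> u \<le> t then a (t - u) + b (t - u) else 0) mod ?q"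
          using shift[OF True] by (simp add: ab_def mult_A mod_mod_cancel le_imp_power_dvd)
        have "\<phi> ab t = ((if t < ?m then a t * ?r + b t * ?r else 0) +
            (if 0 < u \<and> u \<le> t then a (t - u) + b (t - u) else 0)) mod ?q"
          using True mod_add_cong[OF 1 2] by (simp add: \<phi>_def)
        also have "\<dots> = (\<phi> a \<otimes>\<^bsub>A p tau\<^esub> \<phi> b) t"
          using True by (simp add: \<phi>_def mult_A mod_simps) (simp add: algebra_simps)
        finally show ?thesis unfolding ab_def .
      qed (simp add: \<phi>_def mult_A)
    qed
  qed (rule \<phi>_closed)
  interpret \<phi>: group_hom "A p alpha" "A p tau" \<phi> by unfold_locales (fact hom)
  define N where "N = \<phi> ` carrier (A p alpha)"
  have N: "subgroup N (A p tau)" unfolding N_def by (rule \<phi>.img_is_subgroup)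
  interpret N: normal N "A p tau" using N by (rule G.subgroup_imp_normal)
  have inj: "inj_on \<phi> (carrier (A p alpha))"
  proof (rule inj_onI)
    fix c d assume c: "c \<in> carrier (A p alpha)" and d: "d \<in> carrier (A p alpha)" and eq: "\<phi> c = \<phi> d"
    \<comment> \<open>The system is triangular: for \<open>u > 0\<close>, coordinate
      \<open>t\<close> involves only \<open>c t\<close> and the earlier
      \<open>c (t - u)\<close>.\<close>
    have eq_less: "c t = d t" if "t < ?m" for t
      using that
    proof (induction t rule: less_induct)
      case (less t)
      let ?l = "alpha ! t" and ?k = "tau ! t"
      have "0 < u \<and> u \<le> t \<Longrightarrow> c (t - u) = d (t - u)" using less by simp
      then have "int p ^ ?k dvd c t * int p ^ (?k - ?l) - d t * int p ^ (?k - ?l)"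
        using fun_cong[OF eq, of t] less.prems mn
        by (auto simp: \<phi>_def mod_eq_dvd_iff split: if_splits)
      moreover have "int p ^ ?k = int p ^ ?l * int p ^ (?k - ?l)"
        using lk[OF less.prems] by (simp add: power_add[symmetric])
      ultimately have "int p ^ ?l * int p ^ (?k - ?l) dvd (c t - d t) * int p ^ (?k - ?l)"
        by (simp add: left_diff_distrib)
      then have "c t mod int p ^ ?l = d t mod int p ^ ?l"
        using p0 by (simp add: mod_eq_dvd_iff)
      then show ?case using less.prems c d by (simp add: carrier_A)
    qed
    show "c = d"
    proof
      fix t show "c t = d t"
        using eq_less[of t] c d by (cases "t < ?m") (simp_all add: carrier_A)
    qed
  qed
  have "\<phi> \<in> iso (A p alpha) ((A p tau)\<lparr>carrier := N\<rparr>)"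
    using inj hom by (auto simp: iso_def bij_betw_def N_def hom_def)
  then have iso: "(A p tau)\<lparr>carrier := N\<rparr> \<cong> A p alpha"
    using B.iso_sym by (auto simp: is_iso_def)
  define S where "S = unit_A p tau ` {..<u}"
  have S: "finite S" "S \<subseteq> carrier (A p tau)" "card S \<le> u"
    using u p0 unit_A_closed card_image_le[of "{..<u}" "unit_A p tau"] by (auto simp: S_def)
  have "N \<union> S \<subseteq> carrier (A p tau)" using S N.subset by blast
  then have "subgroup (generate (A p tau) (N \<union> S)) (A p tau)"
    by (rule G.generate_is_subgroup)
  then have "generate (A p tau) (N \<union> S) = carrier (A p tau)"
  proof (rule subgroup_A_eq_carrier[OF p0])
    fix t assume t: "t < ?n"
    show "\<exists>z\<in>generate (A p tau) (N \<union> S). z t = 1 mod int p ^ (tau ! t) \<and> (\<forall>j>t. z j = 0)"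
    proof (cases "t < u")
      case True
      then show ?thesis
        by (intro bexI[of _ "unit_A p tau t"]) (auto simp: S_def unit_A_def intro: generate.incl)
    next
      case False
      \<comment> \<open>The image of this unit tuple has entry 1 at \<open>t\<close> and only zeros
        after it, as the triangular criterion requires.\<close>
      let ?c = "unit_A p alpha (t - u)"
      have s: "t - u < ?m" "tau ! t \<le> alpha ! (t - u)" using shift[OF t] False by auto
      have "\<phi> ?c \<in> N" unfolding N_def using s p0 by (intro imageI unit_A_closed)
      then have "\<phi> ?c \<in> generate (A p tau) (N \<union> S)" by (intro generate.incl) simp
      moreover have "\<phi> ?c t = 1 mod int p ^ (tau ! t)"
      \<comment> \<open>For \<open>u = 0\<close>, \<open>shift\<close> and \<open>lk\<close> force
        \<open>alpha ! t = tau ! t\<close>, so the factor \<open>p ^ (tau ! t - alpha ! t)\<close>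
        is 1.\<close>
      proof (cases "u = 0")
        case True
        then show ?thesis using s t lk[of t] by (simp add: \<phi>_def unit_A_def)
      next
        case u0: False
        then show ?thesis
          using s t False by (auto simp: \<phi>_def unit_A_def mod_mod_cancel le_imp_power_dvd)
      qed
      moreover have "\<phi> ?c j = 0" if "j > t" for j
        using that False by (auto simp: \<phi>_def unit_A_def)
      ultimately show ?thesis by blast
    qed
  qed
  then have "rk (A p tau Mod N) \<le> u"
    using N.rk_FactGroup_le[OF S(1,2)] S(3) by simp
  then show ?thesis using N iso by blast
qed

section \<open>Combination of the two bounds\<close>

theorem theorem3p2:
  fixes p :: nat and alpha tau :: "nat list"
  assumes "Factorial_Ring.prime p"
    and "is_type alpha" and "is_type tau" and "tau \<noteq> []"
    and "type_le alpha tau"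
  shows "int (Min {rk (A p tau Mod N) | N. subgroup N (A p tau)
                     \<and> gamma p ((A p tau)\<lparr>carrier := N\<rparr>) = alpha})
         = u_val alpha tau"
proof -
  note p = assms(1) and alpha = assms(2) and tau = assms(3)
  have p0: "p > 0" using prime_gt_0_nat[OF p] .
  interpret G: comm_group "A p tau" by (rule comm_group_A) fact
  have finG: "finite (carrier (A p tau))" using card_carrier_A by blast
  let ?n = "length tau" and ?f = "f_fun alpha tau"
  let ?D = "{int j - int (?f j) | j. j \<in> {1..?n}}"
  let ?M = "{rk (A p tau Mod N) | N. subgroup N (A p tau) \<and> gamma p ((A p tau)\<lparr>carrier := N\<rparr>) = alpha}"
  have n: "?n \<ge> 1" using assms(4) by (cases tau) auto
  have D: "finite ?D" "?D \<noteq> {}" using n by auto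
  have finM: "finite ?M"
    by (rule finite_subset[of _ "(\<lambda>N. rk (A p tau Mod N)) ` Pow (carrier (A p tau))"])
      (use finG subgroup.subset in blast)+
  have lower: "u_val alpha tau \<le> int r" if r: "r \<in> ?M" for r
  proof -
    obtain N where N: "r = rk (A p tau Mod N)" "subgroup N (A p tau)"
      "gamma p ((A p tau)\<lparr>carrier := N\<rparr>) = alpha" using r by blast
    interpret N: normal N "A p tau" using N(2) by (rule G.subgroup_imp_normal)
    obtain h where "h \<in> iso (A p alpha) ((A p tau)\<lparr>carrier := N\<rparr>)"
      using N(3) gamma_subgroup_A_iff[OF p N(2) alpha] group.iso_sym[OF N.subgroup_is_group[OF G.is_group]]
      by (auto simp: is_iso_def)
    then have h: "h \<in> hom (A p alpha) (A p tau)" "h ` carrier (A p alpha) = N"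
      using N.subset by (auto simp: iso_def bij_betw_def hom_def)
    obtain S where S: "finite S" "S \<subseteq> carrier (A p tau)" "card S = rk (A p tau Mod N)"
      "generate (A p tau) (N \<union> S) = carrier (A p tau)"
      using N.rk_FactGroup_witness[OF finG] .
    have "j \<le> ?f j + r" if "j \<in> {1..?n}" for j
      using f_fun_lower_bound[OF p tau that h(1) S(1,2)] S(3,4) h(2) N(1) by simp
    then have "\<forall>x\<in>?D. x \<le> int r" by force
    then show ?thesis unfolding u_val_def using D by simp
  qed
  define u where "u = nat (u_val alpha tau)"
  have u_ge: "int j - int (?f j) \<le> u_val alpha tau" if "j \<in> {1..?n}" for j
    unfolding u_val_def using D(1) that by (intro Max_ge) auto
  have m: "length alpha \<le> ?n" using assms(5) by (simp add: type_le_def)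
  \<comment> \<open>Taking \<open>j = ?n\<close> gives a nonnegative difference, since
    \<open>?f ?n\<close> is at most the length of \<open>alpha\<close>; hence \<open>nat\<close>
    loses nothing.\<close>
  have "0 \<le> u_val alpha tau"
    using u_ge[of ?n] f_fun_le[of alpha tau ?n] n m by simp
  then have int_u: "int u = u_val alpha tau" by (simp add: u_def)
  have u: "u \<le> ?n"
  proof -
    have "u_val alpha tau \<in> ?D" unfolding u_val_def using D by (rule Max_in)
    then show ?thesis using int_u by auto
  qed
  \<comment> \<open>With \<open>j = t + 1\<close> the maximality of \<open>u\<close> gives
    \<open>t - u < ?f (t + 1)\<close>, so the entry of \<open>alpha\<close> at position
    \<open>t - u\<close> is still at least \<open>tau ! t\<close>.\<close>
  have "t - u < length alpha \<and> tau ! t \<le> alpha ! (t - u)" if "t < ?n" "u \<le> t" for t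
  proof -
    have "Suc t \<le> u + ?f (Suc t)" using u_ge[of "Suc t"] that int_u by simp
    then have "t - u < ?f (Suc t)" using that by simp
    then show ?thesis
      using f_fun_le[of alpha tau "Suc t"] f_fun_nth[OF alpha, of "t - u" tau "Suc t"] by simp
  qed
  then obtain N where N: "subgroup N (A p tau)" "(A p tau)\<lparr>carrier := N\<rparr> \<cong> A p alpha" "rk (A p tau Mod N) \<le> u"
    using ex_subgroup_small_quotient[OF p assms(5) u] by blast
  have mem: "rk (A p tau Mod N) \<in> ?M"
    using N gamma_subgroup_A_iff[OF p N(1) alpha] by blast
  then have "?M \<noteq> {}" by blast
  then have "u_val alpha tau \<le> int (Min ?M)"
    by (rule lower[OF Min_in[OF finM]])
  moreover have "Min ?M \<le> u"
    using Min_le[OF finM mem] N(3) by (rule order.trans)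
  ultimately show ?thesis using int_u by linarith
qed

end
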